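(* Let $K_0>0$, $c_\tau>0$ and $\sigma\in(\tfrac12,1]$ be constants, and consider the Euler equations with equation of state $$E(\tau,S)=\frac{K_0\,e^{S/c_\tau}}{2\sigma-1}\,(\ln(\tau+1))^{1-2\sigma},\qquad \tau>0,\ S\in\mathbb{R},$$ so that the pressure is $$p(\tau,S)=\frac{K_0\,e^{S/c_\tau}}{\tau+1}\,(\ln(\tau+1))^{-2\sigma}.$$ Then for arbitrary Riemann data $(\rho_l,u_l,S_l),(\rho_r,u_r,S_r)\in(0,\infty)\times\mathbb{R}\times\mathbb{R}$ there is a unique solution to the Riemann problem, and this solution does not include the vacuum.
   Context: **Equations.** The Euler equations in one space dimension are $$\rho_t+(\rho u)_x=0,\qquad (\rho u)_t+(\rho u^2+p)_x=0,\qquad (\tfrac12\rho u^2+\rho E)_t+(u(\tfrac12\rho u^2+\rho E+p))_x=0,$$ with density $\rho$, specific volume $\tau=1/\rho$, velocity $u$, specific entropy $S$, specific internal energy $E=E(\tau,S)$ and pressure $p=-E_\tau$. Write $\hat p(\rho,S)=p(1/\rho,S)$; the sound speed is $c=\sqrt{\hat p_\rho}$. Define $R(\rho,S)=\int_1^{\rho}\frac{\sqrt{\hat p_\rho(r,S)}}{r}\,dr$. **Elementary waves.** States are $(\rho,u,S)$. For a jump, $[g]=g_{\rm right}-g_{\rm left}$ and $\overline g$ is the average of the left and right values. The state ahead of a backward wave is its left state, and the state ahead of a forward wave is its right state; the other state is the behind state. - Backward rarefaction with left (ahead) state $(\rho_l,u_l,S_l)$: states $(\rho,u,S)$ with $S=S_l$,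 $\rho<\rho_l$, $u-u_l=R(\rho_l,S_l)-R(\rho,S_l)$. - Forward rarefaction with right (ahead) state $(\rho_r,u_r,S_r)$: states with $S=S_r$, $\rho<\rho_r$, $u_r-u=R(\rho_r,S_r)-R(\rho,S_r)$. - Backward or forward shock: $[E]+\overline p\,[\tau]=0$, $[u]=-\sqrt{-[p][\tau]}$, with pressure and density strictly larger behind than ahead. - Contact discontinuity: $[u]=0$, $[p]=0$. **Riemann problem.** The Riemann problem is the Cauchy problem with data equal to a constant state $U_l=(\rho_l,u_l,S_l)$ for $x<0$ and a constant state $U_r=(\rho_r,u_r,S_r)$ for $x>0$, with $\rho_l,\rho_r>0$. A Riemann solution is one of the following. (i) Without vacuum: a pair of intermediate states $U_1,U_2$ of positive density such that $U_l,U_1$ are joined by a backward shock or rarefaction (or are equal), $U_1,U_2$ by a contact (or are equal), and $U_2,U_r$ by a forward shock or rarefaction (or are equal). (ii) Containing a vacuum: a backward rarefaction with left state $U_l$ along which $\rho$ decreases to $0$, and a forward rarefaction with right state $U_r$ along which (from right to left) $\rho$ decreases to $0$, separated by a vacuum region $\rho=0$; the velocity is required to be finite and nondecreasing in $x$, so that the limiting velocities $u_l^*$, $u_r^*$ of the two rarefactions as $\rho\to0$ are finite and satisfy $u_l\le u_l^*\le u_r^*\le u_r$. Existence and uniqueness are understood within this class of solutions. *)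

theory Defs
  imports "HOL-Analysis.Analysis"
begin

text \<open>An equation of state is a function \<open>E \<tau> S\<close> giving the specific internal energy.\<close>

type_synonym eos = "real \<Rightarrow> real \<Rightarrow> real"

definition pressure :: "eos \<Rightarrow> real \<Rightarrow> real \<Rightarrow> real" where
  "pressure E \<tau> S = - deriv (\<lambda>t. E t S) \<tau>"

definition pressure_rho :: "eos \<Rightarrow> real \<Rightarrow> real \<Rightarrow> real" where
  "pressure_rho E \<rho> S = pressure E (1 / \<rho>) S"

definition sound_speed :: "eos \<Rightarrow> real \<Rightarrow> real \<Rightarrow> real" where
  "sound_speed E \<rho> S = sqrt (deriv (\<lambda>r. pressure_rho E r S) \<rho>)"

text \<open>The integral is oriented, so it is negative for \<open>\<rho> < 1\<close>.\<close>

definition R_int :: "eos \<Rightarrow> real \<Rightarrow> real \<Rightarrow> real" where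
  "R_int E \<rho> S = (LBINT r=ereal 1..ereal \<rho>. sound_speed E r S / r)"

datatype state = State (dens: real) (vel: real) (entropy: real)

definition specific_volume :: "state \<Rightarrow> real" where
  "specific_volume U = 1 / dens U"

definition energy_at :: "eos \<Rightarrow> state \<Rightarrow> real" where
  "energy_at E U = E (specific_volume U) (entropy U)"

definition pressure_at :: "eos \<Rightarrow> state \<Rightarrow> real" where
  "pressure_at E U = pressure E (specific_volume U) (entropy U)"

definition jump :: "(state \<Rightarrow> real) \<Rightarrow> state \<Rightarrow> state \<Rightarrow> real" where
  "jump g U V = g V - g U"

definition average :: "(state \<Rightarrow> real) \<Rightarrow> state \<Rightarrow> state \<Rightarrow> real" where
  "average g U V = (g U + g V) / 2"

text \<open>In every wave relation below the first state is the left one and the second is the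
  right one.  The state ahead is the left one for backward waves and the right one for
  forward waves.\<close>

definition backward_rarefaction :: "eos \<Rightarrow> state \<Rightarrow> state \<Rightarrow> bool" where
  "backward_rarefaction E U V \<longleftrightarrow>
     entropy V = entropy U \<and> dens V < dens U \<and>
     vel V - vel U = R_int E (dens U) (entropy U) - R_int E (dens V) (entropy U)"

definition forward_rarefaction :: "eos \<Rightarrow> state \<Rightarrow> state \<Rightarrow> bool" where
  "forward_rarefaction E U V \<longleftrightarrow>
     entropy U = entropy V \<and> dens U < dens V \<and>
     vel V - vel U = R_int E (dens V) (entropy V) - R_int E (dens U) (entropy V)"

definition shock_relations :: "eos \<Rightarrow> state \<Rightarrow> state \<Rightarrow> bool" where
  "shock_relations E U V \<longleftrightarrow>
     jump (energy_at E) U V + average (pressure_at E) U V * jump specific_volume U V = 0 \<and>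
     jump vel U V = - sqrt (- jump (pressure_at E) U V * jump specific_volume U V)"

definition backward_shock :: "eos \<Rightarrow> state \<Rightarrow> state \<Rightarrow> bool" where
  "backward_shock E U V \<longleftrightarrow>
     shock_relations E U V \<and> pressure_at E U < pressure_at E V \<and> dens U < dens V"

definition forward_shock :: "eos \<Rightarrow> state \<Rightarrow> state \<Rightarrow> bool" where
  "forward_shock E U V \<longleftrightarrow>
     shock_relations E U V \<and> pressure_at E V < pressure_at E U \<and> dens V < dens U"

definition contact :: "eos \<Rightarrow> state \<Rightarrow> state \<Rightarrow> bool" where
  "contact E U V \<longleftrightarrow> jump vel U V = 0 \<and> jump (pressure_at E) U V = 0"

text \<open>A Riemann solution without vacuum is given by its two intermediate states; the kind of
  each outer wave is determined by the densities of the states it joins.  A Riemann solution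
  containing a vacuum is given by the velocities at the left and right edges of the vacuum;
  the two rarefactions up to the vacuum are determined by the data.\<close>

datatype riemann_solution =
    No_Vacuum state state
  | Vacuum real real

text \<open>In the vacuum case the velocities along the two complete rarefactions, parametrised by
  the density, have limits as the density decreases to 0.  That these are finite is expressed
  by their being real numbers.\<close>

fun solves_riemann :: "eos \<Rightarrow> state \<Rightarrow> state \<Rightarrow> riemann_solution \<Rightarrow> bool" where
  "solves_riemann E Ul Ur (No_Vacuum U1 U2) \<longleftrightarrow>
     dens U1 > 0 \<and> dens U2 > 0 \<and>
     (backward_shock E Ul U1 \<or> backward_rarefaction E Ul U1 \<or> Ul = U1) \<and>
     (contact E U1 U2 \<or> U1 = U2) \<and>
     (forward_shock E U2 Ur \<or> forward_rarefaction E U2 Ur \<or> U2 = Ur)"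
| "solves_riemann E Ul Ur (Vacuum ul' ur') \<longleftrightarrow>
     (\<exists>v w. (\<forall>\<rho>. 0 < \<rho> \<and> \<rho> < dens Ul \<longrightarrow>
               backward_rarefaction E Ul (State \<rho> (v \<rho>) (entropy Ul))) \<and>
            (\<forall>\<rho>. 0 < \<rho> \<and> \<rho> < dens Ur \<longrightarrow>
               forward_rarefaction E (State \<rho> (w \<rho>) (entropy Ur)) Ur) \<and>
            (v \<longlongrightarrow> ul') (at_right 0) \<and> (w \<longlongrightarrow> ur') (at_right 0)) \<and>
     vel Ul \<le> ul' \<and> ul' \<le> ur' \<and> ur' \<le> vel Ur"

fun has_vacuum :: "riemann_solution \<Rightarrow> bool" where
  "has_vacuum (No_Vacuum U1 U2) \<longleftrightarrow> False"
| "has_vacuum (Vacuum ul' ur') \<longleftrightarrow> True"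

definition log_eos :: "real \<Rightarrow> real \<Rightarrow> real \<Rightarrow> eos" where
  "log_eos K0 c_tau \<sigma> \<tau> S =
     K0 * exp (S / c_tau) / (2 * \<sigma> - 1) * ln (\<tau> + 1) powr (1 - 2 * \<sigma>)"

end

theory Submission
  imports Defs
begin

text \<open>For a fixed ahead state, the states behind a wave are parametrised by their pressure
  \<open>p > 0\<close>: along the isentrope below the ahead pressure, and along the Hugoniot locus above it,
  where \<open>E = p G(\<tau>)\<close> with \<open>G\<close> increasing makes the specific volume a decreasing function
  of \<open>p\<close>.  The velocity difference across the wave is then a strictly increasing function of
  \<open>p\<close>.  It is onto the reals because \<open>R\<close> tends to \<open>-\<infinity>\<close> as \<open>\<rho> \<rightarrow> 0\<close>, hence it is continuous
  without any appeal to the implicit function theorem.  A Riemann solution without vacuum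
  amounts to a pressure at which the two velocity differences add up to \<open>u\<^sub>l - u\<^sub>r\<close>.  The
  same divergence of \<open>R\<close>, which is where \<open>\<sigma> \<le> 1\<close> is needed, rules out a vacuum.\<close>

subsection \<open>Wave curves\<close>

text \<open>In both families \<open>a\<close> is the ahead state and \<open>\<rho>\<close>, \<open>S\<close> belong to the behind state; \<open>y\<close> is the
  velocity on the left of the wave minus the velocity on its right.\<close>

definition wave :: "eos \<Rightarrow> state \<Rightarrow> real \<Rightarrow> real \<Rightarrow> real \<Rightarrow> bool" where
  "wave E a \<rho> S y \<longleftrightarrow> 0 < \<rho> \<and>
     (\<rho> < dens a \<and> S = entropy a \<and> y = R_int E \<rho> (entropy a) - R_int E (dens a) (entropy a) \<or>
      \<rho> = dens a \<and> S = entropy a \<and> y = 0 \<or>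
      dens a < \<rho> \<and> pressure_at E a < pressure E (1 / \<rho>) S \<and>
      E (1 / \<rho>) S - energy_at E a
        + (pressure E (1 / \<rho>) S + pressure_at E a) / 2 * (1 / \<rho> - specific_volume a) = 0 \<and>
      y = sqrt ((pressure E (1 / \<rho>) S - pressure_at E a) * (specific_volume a - 1 / \<rho>)))"

lemma minus_mult_minus_commute: "- (a - b) * (c - d) = (a - b) * (d - c)" for a b c d :: real
  by (simp add: algebra_simps)

lemma backward_wave_iff:
  assumes "0 < dens V"
  shows "backward_shock E U V \<or> backward_rarefaction E U V \<or> U = V \<longleftrightarrow>
    wave E U (dens V) (entropy V) (vel U - vel V)"
proof -
  have "y = x \<longleftrightarrow> - y = - x" for x y :: real
    by simp
  then have "backward_shock E U V \<longleftrightarrow> dens U < dens V \<and> pressure_at E U < pressure_at E V \<and>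
      energy_at E V - energy_at E U
        + (pressure_at E V + pressure_at E U) / 2 * (specific_volume V - specific_volume U) = 0 \<and>
      vel U - vel V =
        sqrt ((pressure_at E V - pressure_at E U) * (specific_volume U - specific_volume V))"
    unfolding backward_shock_def shock_relations_def jump_def average_def minus_mult_minus_commute
    by (auto simp: add.commute)
  moreover have "backward_rarefaction E U V \<longleftrightarrow> dens V < dens U \<and> entropy V = entropy U \<and>
      vel U - vel V = R_int E (dens V) (entropy U) - R_int E (dens U) (entropy U)"
    by (auto simp: backward_rarefaction_def)
  moreover have "U = V \<longleftrightarrow> dens V = dens U \<and> entropy V = entropy U \<and> vel U - vel V = 0"
    by (auto intro: state.expand)
  ultimately show ?thesis
    using assms unfolding wave_def energy_at_def pressure_at_def specific_volume_def by blast
qed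

text \<open>Reflection symmetry: exchanging the two sides negates the whole energy relation and
  keeps the product of the jumps of pressure and specific volume, so counting the velocity
  difference as left minus right gives one predicate for both families.\<close>

lemma forward_wave_iff:
  assumes "0 < dens V"
  shows "forward_shock E V U \<or> forward_rarefaction E V U \<or> V = U \<longleftrightarrow>
    wave E U (dens V) (entropy V) (vel V - vel U)"
proof -
  have energy: "a - b + (c + d) / 2 * (e - f) = 0 \<longleftrightarrow> b - a + (c + d) / 2 * (f - e) = 0"
    for a b c d e f :: real
    by (simp add: field_simps) linarith
  have sqrt_arg: "- (a - b) * (c - d) = (b - a) * (c - d)" for a b c d :: real
    by simp
  have vel: "a - b = - c \<longleftrightarrow> b - a = c" for a b c :: real
    by auto
  have "forward_shock E V U \<longleftrightarrow> dens U < dens V \<and> pressure_at E U < pressure_at E V \<and>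
      energy_at E V - energy_at E U
        + (pressure_at E V + pressure_at E U) / 2 * (specific_volume V - specific_volume U) = 0 \<and>
      vel V - vel U =
        sqrt ((pressure_at E V - pressure_at E U) * (specific_volume U - specific_volume V))"
    unfolding forward_shock_def shock_relations_def jump_def average_def sqrt_arg vel
      energy[of "energy_at E U"] by blast
  moreover have "forward_rarefaction E V U \<longleftrightarrow> dens V < dens U \<and> entropy V = entropy U \<and>
      vel V - vel U = R_int E (dens V) (entropy U) - R_int E (dens U) (entropy U)"
    by (auto simp: forward_rarefaction_def)
  moreover have "V = U \<longleftrightarrow> dens V = dens U \<and> entropy V = entropy U \<and> vel V - vel U = 0"
    by (auto intro: state.expand)
  ultimately show ?thesis
    using assms unfolding wave_def energy_at_def pressure_at_def specific_volume_def by blast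
qed

text \<open>Equal velocity and pressure cover both a contact and \<open>U1 = U2\<close>; positivity
  of the densities is part of \<open>wave\<close>.\<close>

lemma solves_riemann_No_Vacuum_iff:
  "solves_riemann E Ul Ur (No_Vacuum U1 U2) \<longleftrightarrow>
     wave E Ul (dens U1) (entropy U1) (vel Ul - vel U1) \<and>
     wave E Ur (dens U2) (entropy U2) (vel U2 - vel Ur) \<and>
     vel U1 = vel U2 \<and> pressure_at E U1 = pressure_at E U2"
proof (cases "0 < dens U1 \<and> 0 < dens U2")
  case True
  then show ?thesis
    by (auto simp: backward_wave_iff[symmetric] forward_wave_iff[symmetric] contact_def jump_def)
next
  case False
  then show ?thesis by (auto simp: wave_def)
qed

subsection \<open>The Riemann problem for an abstract gas\<close>

text \<open>By \<open>energy_eq\<close> the quotient of energy and pressure depends on the specific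
  volume alone, which removes the entropy from the Hugoniot relation. \<open>R_unbounded\<close>
  yields rarefactions with arbitrarily large velocity change.\<close>

locale riemann_gas =
  fixes E :: eos and G :: "real \<Rightarrow> real"
  assumes pressure_pos: "0 < \<tau> \<Longrightarrow> 0 < pressure E \<tau> S"
    and pressure_less: "0 < \<tau> \<Longrightarrow> \<tau> < \<tau>' \<Longrightarrow> pressure E \<tau>' S < pressure E \<tau> S"
    and pressure_ex: "0 < \<tau> \<Longrightarrow> 0 < p \<Longrightarrow> p < pressure E \<tau> S \<Longrightarrow> \<exists>\<tau>'>\<tau>. pressure E \<tau>' S = p"
    and entropy_ex1: "0 < \<tau> \<Longrightarrow> 0 < p \<Longrightarrow> \<exists>!S. pressure E \<tau> S = p"
    and energy_eq: "0 < \<tau> \<Longrightarrow> E \<tau> S = pressure E \<tau> S * G \<tau>"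
    and G_cont: "continuous_on {0..} G"
    and G_0: "G 0 = 0"
    and G_less: "0 \<le> x \<Longrightarrow> x < y \<Longrightarrow> G x < G y"
    and R_less: "0 < \<rho> \<Longrightarrow> \<rho> < \<rho>' \<Longrightarrow> R_int E \<rho> S < R_int E \<rho>' S"
    and R_cont: "continuous_on {0<..} (\<lambda>\<rho>. R_int E \<rho> S)"
    and R_unbounded: "\<exists>\<rho>>0. R_int E \<rho> S < b"
begin

section \<open>The Hugoniot relation between pressure and specific volume\<close>

text \<open>The energy relation of a shock after substituting \<open>energy_eq\<close>;
  \<open>pa\<close> and \<open>\<tau>a\<close> belong to the ahead state.\<close>

definition hugoniot :: "real \<Rightarrow> real \<Rightarrow> real \<Rightarrow> real \<Rightarrow> bool" where
  "hugoniot pa \<tau>a p \<tau> \<longleftrightarrow> p * G \<tau> - pa * G \<tau>a + (p + pa) / 2 * (\<tau> - \<tau>a) = 0"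

lemma G_pos: "0 < \<tau> \<Longrightarrow> 0 < G \<tau>"
  using G_less[of 0 \<tau>] G_0 by simp

text \<open>Intermediate value theorem in \<tau> at fixed \<open>p\<close>: the left-hand side is
  negative at 0 because \<open>G 0 = 0\<close>, and at \<open>\<tau>a\<close> it equals
  \<open>(p - pa) * G \<tau>a\<close>.\<close>

lemma hugoniot_ex:
  assumes "0 < pa" "pa < p" "0 < \<tau>a"
  shows "\<exists>\<tau>. 0 < \<tau> \<and> \<tau> < \<tau>a \<and> hugoniot pa \<tau>a p \<tau>"
proof -
  define F where "F \<tau> = p * G \<tau> - pa * G \<tau>a + (p + pa) / 2 * (\<tau> - \<tau>a)" for \<tau>
  have "continuous_on {0..\<tau>a} F"
    unfolding F_def by (intro continuous_intros continuous_on_subset[OF G_cont]) auto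
  moreover have "(p + pa) * \<tau>a > 0" "pa * G \<tau>a > 0"
    using assms G_pos by simp_all
  then have F0: "F 0 < 0"
    by (simp add: F_def G_0)
  moreover have "(p - pa) * G \<tau>a > 0"
    using assms G_pos by simp
  then have F1: "0 < F \<tau>a"
    by (simp add: F_def algebra_simps)
  ultimately obtain \<tau> where "0 \<le> \<tau>" "\<tau> \<le> \<tau>a" "F \<tau> = 0"
    using IVT'[of F 0 0 \<tau>a] assms by force
  with F0 F1 show ?thesis
    unfolding hugoniot_def F_def[symmetric]
    by (metis order_le_less order_less_irrefl)
qed

text \<open>If \<tau> < \<tau>', the difference of the two relations is a sum of one nonnegative and
  two positive terms and cannot vanish. Admitting \<open>p = p'\<close> also gives uniqueness of the
  volume at a given pressure.\<close>

lemma hugoniot_antimono: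
  assumes "0 < pa" "pa < p" "p \<le> p'" "0 < \<tau>" "\<tau> < \<tau>a" "0 < \<tau>'"
    and "hugoniot pa \<tau>a p \<tau>" "hugoniot pa \<tau>a p' \<tau>'"
  shows "\<tau>' \<le> \<tau>"
proof (rule ccontr)
  assume "\<not> \<tau>' \<le> \<tau>"
  then have less: "\<tau> < \<tau>'" by simp
  \<comment> \<open>Collecting the multiples of \<open>p\<close> in the first relation shows that
    the coefficient of \<open>p' - p\<close> in the difference is positive.\<close>
  have "p * (G \<tau> + (\<tau> - \<tau>a) / 2) = pa * (G \<tau>a + (\<tau>a - \<tau>) / 2)"
    using assms(7) unfolding hugoniot_def by (simp add: field_simps)
  also have "\<dots> > 0"
    using assms G_pos[of \<tau>a] by (intro mult_pos_pos add_pos_pos) auto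
  finally have "0 < G \<tau> + (\<tau> - \<tau>a) / 2"
    using assms by (simp add: zero_less_mult_iff)
  then have "0 \<le> (p' - p) * (G \<tau> + (\<tau> - \<tau>a) / 2)"
    using assms by (intro mult_nonneg_nonneg) auto
  moreover have "0 < p' * (G \<tau>' - G \<tau>)"
    using less assms G_less[of \<tau> \<tau>'] by simp
  moreover have "0 < (p' + pa) / 2 * (\<tau>' - \<tau>)"
    using less assms by simp
  ultimately show False
    using assms(7,8) unfolding hugoniot_def by (simp add: field_simps)
qed

text \<open>Prescribes the velocity drop \<open>y\<close> of the shock instead of its pressure;
  needed for shocks to attain every positive drop.\<close>

lemma hugoniot_jump_ex:
  assumes "0 < pa" "0 < \<tau>a" "0 < y"
  shows "\<exists>p \<tau>. pa < p \<and> 0 < \<tau> \<and> \<tau> < \<tau>a \<and> hugoniot pa \<tau>a p \<tau> \<and> (p - pa) * (\<tau>a - \<tau>) = y\<^sup>2"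
proof -
  \<comment> \<open>Eliminating \<open>p\<close> from the two equations leaves \<open>H \<tau> = 0\<close>.\<close>
  define H where "H \<tau> = (pa * (\<tau>a - \<tau>) + y\<^sup>2) * G \<tau>
    - (\<tau>a - \<tau>) * (pa * G \<tau>a + pa * (\<tau>a - \<tau>) + y\<^sup>2 / 2)" for \<tau>
  have "continuous_on {0..\<tau>a} H"
    unfolding H_def by (intro continuous_intros continuous_on_subset[OF G_cont]) auto
  moreover have "0 < \<tau>a * (pa * G \<tau>a + pa * \<tau>a + y\<^sup>2 / 2)"
    using assms G_pos by (intro mult_pos_pos add_pos_pos) auto
  then have H0: "H 0 < 0"
    by (simp add: H_def G_0)
  moreover have H1: "0 < H \<tau>a"
    using assms G_pos by (simp add: H_def)
  ultimately obtain \<tau> where \<tau>: "0 \<le> \<tau>" "\<tau> \<le> \<tau>a" "H \<tau> = 0"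
    using IVT'[of H 0 0 \<tau>a] assms by force
  with H0 H1 have less: "0 < \<tau>" "\<tau> < \<tau>a"
    by (metis order_le_less order_less_irrefl)+
  define p where "p = pa + y\<^sup>2 / (\<tau>a - \<tau>)"
  have jump: "(p - pa) * (\<tau>a - \<tau>) = y\<^sup>2"
    using less by (simp add: p_def)
  \<comment> \<open>Multiplied by the positive factor \<open>\<tau>a - \<tau>\<close>, the Hugoniot
    expression becomes \<open>H \<tau>\<close>.\<close>
  have "(\<tau>a - \<tau>) * (p * G \<tau> - pa * G \<tau>a + (p + pa) / 2 * (\<tau> - \<tau>a)) =
      (pa * (\<tau>a - \<tau>) + (p - pa) * (\<tau>a - \<tau>)) * G \<tau>
      - (\<tau>a - \<tau>) * (pa * G \<tau>a + pa * (\<tau>a - \<tau>) + (p - pa) * (\<tau>a - \<tau>) / 2)"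
    by (simp add: field_simps)
  also have "\<dots> = 0"
    using \<tau>(3) by (simp add: jump H_def)
  finally have "hugoniot pa \<tau>a p \<tau>"
    using less by (simp add: hugoniot_def)
  moreover have "pa < p"
    using less assms by (simp add: p_def)
  ultimately show ?thesis
    using less jump by blast
qed

section \<open>Wave curves parametrised by the pressure behind\<close>

text \<open>On the isentrope both the pressure and \<open>R_int\<close> increase with density, and
  behind a shock both factors under the root are positive. Hence the sign of \<open>y\<close> and
  the comparison with the ahead pressure each identify the branch.\<close>

lemma wave_cases:
  assumes "0 < dens a" "wave E a \<rho> S y"
  obtains
    (rarefaction) "0 < \<rho>" "\<rho> < dens a" "S = entropy a"
      "y = R_int E \<rho> (entropy a) - R_int E (dens a) (entropy a)" "y < 0"
      "pressure E (1 / \<rho>) S < pressure_at E a"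
  | (trivial) "\<rho> = dens a" "S = entropy a" "y = 0" "pressure E (1 / \<rho>) S = pressure_at E a"
  | (shock) "dens a < \<rho>" "1 / \<rho> < specific_volume a" "pressure_at E a < pressure E (1 / \<rho>) S"
      "hugoniot (pressure_at E a) (specific_volume a) (pressure E (1 / \<rho>) S) (1 / \<rho>)"
      "y = sqrt ((pressure E (1 / \<rho>) S - pressure_at E a) * (specific_volume a - 1 / \<rho>))"
      "0 < y"
proof -
  have \<rho>: "0 < \<rho>"
    using assms by (simp add: wave_def)
  consider "\<rho> < dens a" | "\<rho> = dens a" | "dens a < \<rho>"
    by linarith
  then show ?thesis
  proof cases
    case 1
    then have "pressure E (1 / \<rho>) (entropy a) < pressure E (1 / dens a) (entropy a)"
      using \<rho> assms by (intro pressure_less) (auto simp: field_simps)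
    with 1 assms \<rho> show ?thesis
      using R_less[of \<rho> "dens a" "entropy a"]
      by (intro rarefaction) (auto simp: wave_def pressure_at_def specific_volume_def)
  next
    case 2
    with assms show ?thesis
      by (intro trivial) (auto simp: wave_def pressure_at_def specific_volume_def)
  next
    case 3
    then have "1 / \<rho> < specific_volume a"
      using assms by (simp add: specific_volume_def field_simps)
    with 3 assms \<rho> show ?thesis
      by (intro shock) (auto simp: wave_def hugoniot_def energy_eq energy_at_def pressure_at_def
          specific_volume_def)
  qed
qed

text \<open>A Hugoniot point fixes only pressure and volume; \<open>entropy_ex1\<close> recovers the
  entropy behind.\<close>

lemma wave_shockI:
  assumes "0 < dens a" "0 < \<tau>" "\<tau> < specific_volume a" "pressure_at E a < p"
    and "hugoniot (pressure_at E a) (specific_volume a) p \<tau>"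
  shows "\<exists>S. pressure E \<tau> S = p \<and>
    wave E a (1 / \<tau>) S (sqrt ((p - pressure_at E a) * (specific_volume a - \<tau>)))"
proof -
  have "0 < pressure_at E a"
    using assms by (simp add: pressure_at_def specific_volume_def pressure_pos)
  then obtain S where "pressure E \<tau> S = p"
    using entropy_ex1[of \<tau> p] assms by auto
  moreover have "dens a < 1 / \<tau>"
    using assms by (simp add: specific_volume_def field_simps)
  ultimately show ?thesis
    using assms
    by (intro exI[of _ S])
      (simp add: wave_def hugoniot_def energy_eq energy_at_def pressure_at_def specific_volume_def)
qed

lemma wave_ex:
  assumes "0 < dens a" "0 < p"
  shows "\<exists>\<rho> S y. wave E a \<rho> S y \<and> pressure E (1 / \<rho>) S = p"
proof -
  have v: "0 < specific_volume a"
    using assms by (simp add: specific_volume_def)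
  consider "p < pressure_at E a" | "p = pressure_at E a" | "pressure_at E a < p"
    by linarith
  then show ?thesis
  proof cases
    case 1
    then obtain \<tau> where "specific_volume a < \<tau>" "pressure E \<tau> (entropy a) = p"
      using pressure_ex[of "specific_volume a" p "entropy a"] v assms
      by (auto simp: pressure_at_def)
    moreover from this have "0 < \<tau>"
      using v by simp
    moreover from calculation have "1 / \<tau> < dens a"
      using assms by (simp add: specific_volume_def field_simps)
    ultimately have "wave E a (1 / \<tau>) (entropy a)
        (R_int E (1 / \<tau>) (entropy a) - R_int E (dens a) (entropy a))"
      "pressure E (1 / (1 / \<tau>)) (entropy a) = p"
      by (auto simp: wave_def)
    then show ?thesis
      by blast
  next
    case 2
    then have "wave E a (dens a) (entropy a) 0" "pressure E (1 / dens a) (entropy a) = p"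
      using assms by (auto simp: wave_def pressure_at_def specific_volume_def)
    then show ?thesis
      by blast
  next
    case 3
    then obtain \<tau> where "0 < \<tau>" "\<tau> < specific_volume a"
      "hugoniot (pressure_at E a) (specific_volume a) p \<tau>"
      using hugoniot_ex[of "pressure_at E a" p "specific_volume a"] v
      by (auto simp: pressure_at_def pressure_pos)
    with wave_shockI[OF assms(1) this(1,2) 3 this(3)] show ?thesis
      by (metis div_by_1 divide_divide_eq_right mult_1)
  qed
qed

lemma pressure_less_iff:
  assumes "0 < \<rho>" "0 < \<rho>'"
  shows "pressure E (1 / \<rho>) S < pressure E (1 / \<rho>') S \<longleftrightarrow> \<rho> < \<rho>'"
proof -
  have "\<rho> < \<rho>' \<Longrightarrow> pressure E (1 / \<rho>) S < pressure E (1 / \<rho>') S" if "0 < \<rho>" for \<rho> \<rho>'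
    using that by (intro pressure_less) (auto simp: field_simps)
  from this[of \<rho> \<rho>'] this[of \<rho>' \<rho>] show ?thesis
    using assms by (cases \<rho> \<rho>' rule: linorder_cases) auto
qed

text \<open>Equal pressures force the same branch. On the isentrope pressure determines density; on
  the Hugoniot locus \<open>hugoniot_antimono\<close>, used in both directions, gives equal volumes,
  and then pressure and volume determine the entropy.\<close>

lemma wave_unique:
  assumes a: "0 < dens a" and w: "wave E a \<rho> S y" and w': "wave E a \<rho>' S' y'"
    and p: "pressure E (1 / \<rho>) S = pressure E (1 / \<rho>') S'"
  shows "\<rho> = \<rho>' \<and> S = S' \<and> y = y'"
proof -
  have pos: "0 < \<rho>" "0 < \<rho>'"
    using w w' by (auto simp: wave_def)
  have pa: "0 < pressure_at E a"
    using a by (simp add: pressure_at_def specific_volume_def pressure_pos)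
  from a w show ?thesis
  proof (cases rule: wave_cases)
    case rarefaction
    from a w' show ?thesis
    proof (cases rule: wave_cases)
      case R': rarefaction
      have "\<rho> = \<rho>'"
        using p pressure_less_iff[OF pos] pressure_less_iff[OF pos(2,1)] rarefaction R'
        by (metis less_irrefl linorder_neqE)
      with rarefaction R' show ?thesis by simp
    qed (use p rarefaction in auto)
  next
    case trivial
    from a w' show ?thesis
      by (cases rule: wave_cases) (use p trivial in auto)
  next
    case shock
    from a w' show ?thesis
    proof (cases rule: wave_cases)
      case S': shock
      have "1 / \<rho> = 1 / \<rho>'"
        using hugoniot_antimono[OF pa shock(3) _ _ shock(2) _ shock(4) S'(4)]
          hugoniot_antimono[OF pa S'(3) _ _ S'(2) _ S'(4) shock(4)] p pos
        by simp
      then have \<rho>: "\<rho> = \<rho>'" by simp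
      moreover have "S = S'"
        using entropy_ex1[of "1 / \<rho>" "pressure E (1 / \<rho>) S"] pressure_pos p pos \<rho> by auto
      ultimately show ?thesis
        using shock S' by simp
    qed (use p shock in auto)
  qed
qed

text \<open>Different branches are separated by the sign of \<open>y\<close>. Among rarefactions
  \<open>R_int\<close> is increasing; among shocks the pressure jump grows strictly while the volume
  jump does not shrink.\<close>

lemma wave_less:
  assumes a: "0 < dens a" and w: "wave E a \<rho> S y" and w': "wave E a \<rho>' S' y'"
    and p: "pressure E (1 / \<rho>) S < pressure E (1 / \<rho>') S'"
  shows "y < y'"
proof -
  have pos: "0 < \<rho>" "0 < \<rho>'"
    using w w' by (auto simp: wave_def)
  have pa: "0 < pressure_at E a"
    using a by (simp add: pressure_at_def specific_volume_def pressure_pos)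
  from a w show ?thesis
  proof (cases rule: wave_cases)
    case rarefaction
    from a w' show ?thesis
    proof (cases rule: wave_cases)
      case R': rarefaction
      have "\<rho> < \<rho>'"
        using p pressure_less_iff[OF pos] rarefaction R' by simp
      with rarefaction R' show ?thesis
        using R_less[OF pos(1)] by simp
    qed (use rarefaction(5) in linarith)+
  next
    case trivial
    from a w' show ?thesis
      by (cases rule: wave_cases) (use p trivial in auto)
  next
    case shock
    from a w' show ?thesis
    proof (cases rule: wave_cases)
      case S': shock
      have "1 / \<rho>' \<le> 1 / \<rho>"
        using hugoniot_antimono[OF pa shock(3) _ _ shock(2) _ shock(4) S'(4)] p pos by simp
      then show ?thesis
        unfolding shock(5) S'(5)
        using p shock S' by (intro real_sqrt_less_mono mult_less_le_imp_less) auto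
    qed (use p shock in auto)
  qed
qed

lemma wave_onto:
  assumes "0 < dens a"
  shows "\<exists>\<rho> S. wave E a \<rho> S y"
proof -
  let ?R = "\<lambda>\<rho>. R_int E \<rho> (entropy a)"
  consider "y < 0" | "y = 0" | "0 < y"
    by linarith
  then show ?thesis
  proof cases
    case 1
    \<comment> \<open>At \<open>\<rho>0\<close> the rarefaction overshoots the drop
      \<open>y\<close>, so an intermediate density attains it.\<close>
    obtain \<rho>0 where \<rho>0: "0 < \<rho>0" "?R \<rho>0 < ?R (dens a) + y"
      using R_unbounded by blast
    then have "\<rho>0 < dens a"
      using R_less[of "dens a" \<rho>0 "entropy a"] assms 1
      by (cases \<rho>0 "dens a" rule: linorder_cases) auto
    moreover have "continuous_on {\<rho>0..dens a} ?R"
      using \<rho>0 by (intro continuous_on_subset[OF R_cont]) auto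
    ultimately obtain \<rho> where \<rho>: "\<rho>0 \<le> \<rho>" "\<rho> \<le> dens a" "?R \<rho> = ?R (dens a) + y"
      using IVT'[of ?R \<rho>0 "?R (dens a) + y" "dens a"] \<rho>0 1 by auto
    moreover have "\<rho> \<noteq> dens a"
      using \<rho> 1 by auto
    ultimately have "wave E a \<rho> (entropy a) y"
      using \<rho>0 by (auto simp: wave_def)
    then show ?thesis by blast
  next
    case 2
    then have "wave E a (dens a) (entropy a) y"
      using assms by (simp add: wave_def)
    then show ?thesis by blast
  next
    case 3
    have "0 < pressure_at E a" "0 < specific_volume a"
      using assms by (auto simp: pressure_at_def specific_volume_def pressure_pos)
    then obtain p \<tau> where "pressure_at E a < p" "0 < \<tau>" "\<tau> < specific_volume a"
      "hugoniot (pressure_at E a) (specific_volume a) p \<tau>"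
      "(p - pressure_at E a) * (specific_volume a - \<tau>) = y\<^sup>2"
      using hugoniot_jump_ex 3 by blast
    with wave_shockI[OF assms this(2,3,1,4)] 3 show ?thesis
      by auto
  qed
qed

section \<open>The velocity drop as a function of pressure\<close>

text \<open>The description is proper for positive \<open>p\<close> and \<open>dens a\<close>, by
  \<open>wave_ex\<close> and \<open>wave_unique\<close>; elsewhere the value is unspecified.\<close>

definition velocity_drop :: "state \<Rightarrow> real \<Rightarrow> real" where
  "velocity_drop a p = (THE y. \<exists>\<rho> S. wave E a \<rho> S y \<and> pressure E (1 / \<rho>) S = p)"

lemma velocity_drop_eq:
  assumes "0 < dens a" "wave E a \<rho> S y"
  shows "velocity_drop a (pressure E (1 / \<rho>) S) = y"
  unfolding velocity_drop_def
  using assms wave_unique[OF assms(1)] by (intro the_equality) blast+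

lemma velocity_drop_wave:
  assumes "0 < dens a" "0 < p"
  shows "\<exists>\<rho> S. wave E a \<rho> S (velocity_drop a p) \<and> pressure E (1 / \<rho>) S = p"
  using wave_ex[OF assms] velocity_drop_eq[OF assms(1)] by metis

lemma velocity_drop_less:
  assumes "0 < dens a" "0 < p" "p < p'"
  shows "velocity_drop a p < velocity_drop a p'"
proof -
  obtain \<rho> S \<rho>' S' where
    "wave E a \<rho> S (velocity_drop a p)" "pressure E (1 / \<rho>) S = p"
    "wave E a \<rho>' S' (velocity_drop a p')" "pressure E (1 / \<rho>') S' = p'"
    using velocity_drop_wave[of a p] velocity_drop_wave[of a p'] assms by fastforce
  with wave_less[OF assms(1)] assms(3) show ?thesis
    by blast
qed

lemma velocity_drop_onto:
  assumes "0 < dens a"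
  shows "\<exists>p>0. velocity_drop a p = y"
proof -
  obtain \<rho> S where w: "wave E a \<rho> S y"
    using wave_onto assms by blast
  then have "0 < pressure E (1 / \<rho>) S"
    by (simp add: wave_def pressure_pos)
  with velocity_drop_eq[OF assms w] show ?thesis
    by blast
qed

lemma velocity_drop_mono:
  assumes "0 < dens a" "0 < p" "p \<le> p'"
  shows "velocity_drop a p \<le> velocity_drop a p'"
  using velocity_drop_less[of a p p'] assms by (cases "p = p'") auto

text \<open>A monotone function can only have jumps, and an open image excludes them; here the image
  is the whole line.\<close>

lemma velocity_drop_continuous:
  assumes "0 < dens a"
  shows "continuous_on {0<..} (velocity_drop a)"
proof (rule continuous_onI_mono)
  have "velocity_drop a ` {0<..} = UNIV"
  proof -
    have "y \<in> velocity_drop a ` {0<..}" for y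
      using velocity_drop_onto[OF assms, of y] by auto
    then show ?thesis by blast
  qed
  then show "open (velocity_drop a ` {0<..})"
    by simp
qed (use velocity_drop_mono assms in auto)

lemma middle_pressure_ex1:
  assumes "0 < dens a" "0 < dens b"
  shows "\<exists>!p. 0 < p \<and> velocity_drop a p + velocity_drop b p = d"
proof (rule ex_ex1I)
  let ?f = "\<lambda>p. velocity_drop a p + velocity_drop b p"
  \<comment> \<open>Each wave is given half of \<open>d\<close>. At the smaller of the two pressures
    both drops are at most \<open>d / 2\<close>, at the larger one at least \<open>d / 2\<close>,
    which brackets the sum.\<close>
  obtain p q where p: "0 < p" "velocity_drop a p = d / 2" and q: "0 < q" "velocity_drop b q = d / 2"
    using velocity_drop_onto assms by meson
  define m M where "m = min p q" and "M = max p q"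
  have "velocity_drop a m \<le> d / 2" "velocity_drop b m \<le> d / 2"
    "d / 2 \<le> velocity_drop a M" "d / 2 \<le> velocity_drop b M"
    using velocity_drop_mono[OF assms(1), of m p] velocity_drop_mono[OF assms(1), of p M]
      velocity_drop_mono[OF assms(2), of m q] velocity_drop_mono[OF assms(2), of q M] p q
    by (auto simp: m_def M_def)
  then have "?f m \<le> d" "d \<le> ?f M" by linarith+
  moreover have "continuous_on {m..M} ?f"
    using p q
    by (intro continuous_on_add continuous_on_subset[OF velocity_drop_continuous] assms)
      (auto simp: m_def)
  moreover have "m \<le> M" "0 < m"
    using p q by (auto simp: m_def M_def)
  ultimately show "\<exists>p. 0 < p \<and> ?f p = d"
    using IVT'[of ?f m d M] by (metis less_le_trans)
next
  fix p q
  assume p: "0 < p \<and> velocity_drop a p + velocity_drop b p = d"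
    and q: "0 < q \<and> velocity_drop a q + velocity_drop b q = d"
  show "p = q"
    using velocity_drop_less[OF assms(1), of p q] velocity_drop_less[OF assms(2), of p q]
      velocity_drop_less[OF assms(1), of q p] velocity_drop_less[OF assms(2), of q p] p q
    by (cases p q rule: linorder_cases) auto
qed

text \<open>Along the left rarefaction the velocity is a constant minus \<open>R_int\<close>, which
  grows without bound as the density tends to 0, against the finite limit \<open>ul\<close>.\<close>

lemma no_vacuum:
  assumes "0 < dens Ul" "solves_riemann E Ul Ur w"
  shows "\<not> has_vacuum w"
proof (cases w)
  case (Vacuum ul ur)
  then obtain v where v: "\<And>\<rho>. 0 < \<rho> \<Longrightarrow> \<rho> < dens Ul \<Longrightarrow>
      backward_rarefaction E Ul (State \<rho> (v \<rho>) (entropy Ul))"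
    and lim: "(v \<longlongrightarrow> ul) (at_right 0)"
    using assms by auto
  let ?R = "\<lambda>\<rho>. R_int E \<rho> (entropy Ul)"
  \<comment> \<open>Below \<open>\<rho>0\<close> the rarefaction velocity exceeds
    \<open>ul + 1\<close>, while convergence keeps it below \<open>ul + 1\<close> near 0.\<close>
  obtain \<rho>0 where \<rho>0: "0 < \<rho>0" "?R \<rho>0 < ?R (dens Ul) + vel Ul - (ul + 1)"
    using R_unbounded by blast
  have "eventually (\<lambda>\<rho>. v \<rho> < ul + 1) (at_right 0)"
    using lim by (rule order_tendstoD) simp
  moreover have "eventually (\<lambda>\<rho>. \<rho> \<in> {0<..<min \<rho>0 (dens Ul)}) (at_right 0)"
    using \<rho>0 assms by (intro eventually_at_right_real) simp
  ultimately have "eventually (\<lambda>\<rho>. False) (at_right (0 :: real))"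
  proof eventually_elim
    case (elim \<rho>)
    then have "v \<rho> - vel Ul = ?R (dens Ul) - ?R \<rho>"
      using v[of \<rho>] by (simp add: backward_rarefaction_def)
    moreover have "?R \<rho> < ?R \<rho>0"
      using elim by (intro R_less) auto
    ultimately show False
      using \<rho>0 elim by linarith
  qed
  then show ?thesis by simp
qed simp

text \<open>Adding the two drops cancels the common middle velocity, so the middle pressure of any
  solution satisfies the equation of \<open>middle_pressure_ex1\<close>.\<close>

theorem riemann_ex1:
  assumes l: "0 < dens Ul" and r: "0 < dens Ur"
  shows "\<exists>!w. solves_riemann E Ul Ur w"
proof -
  obtain p where p: "0 < p" "velocity_drop Ul p + velocity_drop Ur p = vel Ul - vel Ur"
    and p_unique: "\<And>q. 0 < q \<Longrightarrow>
      velocity_drop Ul q + velocity_drop Ur q = vel Ul - vel Ur \<Longrightarrow> q = p"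
    using middle_pressure_ex1[OF l r, of "vel Ul - vel Ur"] by blast
  obtain \<rho>1 S1 where w1: "wave E Ul \<rho>1 S1 (velocity_drop Ul p)" "pressure E (1 / \<rho>1) S1 = p"
    using velocity_drop_wave l p by blast
  obtain \<rho>2 S2 where w2: "wave E Ur \<rho>2 S2 (velocity_drop Ur p)" "pressure E (1 / \<rho>2) S2 = p"
    using velocity_drop_wave r p by blast
  \<comment> \<open>The middle velocity reached from the left; the equation for \<open>p\<close>
    says that the right wave gives the same value.\<close>
  define u where "u = vel Ul - velocity_drop Ul p"
  have u: "vel Ul - u = velocity_drop Ul p" "u - vel Ur = velocity_drop Ur p"
    using p by (auto simp: u_def)
  show ?thesis
  proof (rule ex1I)
    show "solves_riemann E Ul Ur (No_Vacuum (State \<rho>1 u S1) (State \<rho>2 u S2))"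
      using w1 w2 u
      by (simp add: solves_riemann_No_Vacuum_iff pressure_at_def specific_volume_def
          del: solves_riemann.simps)
  next
    fix w assume sol: "solves_riemann E Ul Ur w"
    show "w = No_Vacuum (State \<rho>1 u S1) (State \<rho>2 u S2)"
    proof (cases w)
      case (No_Vacuum U1 U2)
      define q where "q = pressure_at E U1"
      have W1: "wave E Ul (dens U1) (entropy U1) (vel Ul - vel U1)"
        and W2: "wave E Ur (dens U2) (entropy U2) (vel U2 - vel Ur)"
        and vel: "vel U1 = vel U2"
        and q1: "pressure E (1 / dens U1) (entropy U1) = q"
        and q2: "pressure E (1 / dens U2) (entropy U2) = q"
        using sol unfolding No_Vacuum solves_riemann_No_Vacuum_iff
        by (auto simp: q_def pressure_at_def specific_volume_def)
      have "0 < q"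
        using W1 q1 by (auto simp: wave_def pressure_pos)
      moreover have "velocity_drop Ul q = vel Ul - vel U1" "velocity_drop Ur q = vel U2 - vel Ur"
        using velocity_drop_eq[OF l W1] velocity_drop_eq[OF r W2] q1 q2 by auto
      ultimately have "q = p"
        using vel by (intro p_unique) auto
      then have "dens U1 = \<rho>1 \<and> entropy U1 = S1 \<and> vel Ul - vel U1 = velocity_drop Ul p"
        "dens U2 = \<rho>2 \<and> entropy U2 = S2 \<and> vel U2 - vel Ur = velocity_drop Ur p"
        using wave_unique[OF l W1 w1(1)] wave_unique[OF r W2 w2(1)] w1 w2 q1 q2 by auto
      with u vel No_Vacuum show ?thesis
        by (auto intro!: state.expand)
    next
      case (Vacuum ul ur)
      with no_vacuum[OF l sol] show ?thesis by simp
    qed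
  qed
qed

end

subsection \<open>The logarithmic equation of state\<close>

locale log_gas =
  fixes K0 c_tau \<sigma> :: real
  assumes K0_pos: "0 < K0" and c_tau_pos: "0 < c_tau" and \<sigma>_gt: "1 / 2 < \<sigma>" and \<sigma>_le: "\<sigma> \<le> 1"
begin

abbreviation E :: eos where "E \<equiv> log_eos K0 c_tau \<sigma>"

lemma pressure_eq:
  assumes "0 < \<tau>"
  shows "pressure E \<tau> S = K0 * exp (S / c_tau) / (\<tau> + 1) * ln (\<tau> + 1) powr (- 2 * \<sigma>)"
proof -
  have "((\<lambda>t. ln (t + 1) powr (1 - 2 * \<sigma>)) has_real_derivative
      (1 - 2 * \<sigma>) * ln (\<tau> + 1) powr (1 - 2 * \<sigma> - 1) * (1 / (\<tau> + 1))) (at \<tau>)"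
    using assms
    by (intro DERIV_chain2[where f = "\<lambda>z. z powr (1 - 2 * \<sigma>)"] has_real_derivative_powr)
      (auto intro!: derivative_eq_intros)
  from DERIV_cmult[OF this, of "K0 * exp (S / c_tau) / (2 * \<sigma> - 1)"]
  have "deriv (\<lambda>t. E t S) \<tau> = K0 * exp (S / c_tau) / (2 * \<sigma> - 1) *
      ((1 - 2 * \<sigma>) * ln (\<tau> + 1) powr (1 - 2 * \<sigma> - 1) * (1 / (\<tau> + 1)))"
    unfolding log_eos_def by (rule DERIV_imp_deriv)
  also have "\<dots> = - (K0 * exp (S / c_tau) / (\<tau> + 1) * ln (\<tau> + 1) powr (- 2 * \<sigma>))"
  proof -
    have "A / (2 * \<sigma> - 1) * ((1 - 2 * \<sigma>) * x * (1 / (\<tau> + 1))) = - (A / (\<tau> + 1) * x)" for A x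
      using assms \<sigma>_gt by (simp add: divide_simps) (simp add: algebra_simps)
    then show ?thesis by simp
  qed
  finally show ?thesis
    by (simp add: pressure_def)
qed

lemma ln_inverse_pos: "0 < ln (1 / \<rho> + 1)" if "0 < \<rho>" for \<rho> :: real
  using that by (intro ln_gt_zero) simp

lemma ln_inverse_deriv:
  assumes "0 < \<rho>"
  shows "((\<lambda>r. ln (1 / r + 1)) has_real_derivative - 1 / (\<rho> * (\<rho> + 1))) (at \<rho>)"
proof -
  have "((\<lambda>r. 1 / r + 1) has_real_derivative - 1 / (\<rho> * \<rho>)) (at \<rho>)"
    using DERIV_add[OF DERIV_inverse DERIV_const[of 1], of \<rho>] assms
    by (simp add: inverse_eq_divide power2_eq_square)
  from DERIV_ln_divide[THEN DERIV_chain2, OF _ this]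
  have "((\<lambda>r. ln (1 / r + 1)) has_real_derivative 1 / (1 / \<rho> + 1) * (- 1 / (\<rho> * \<rho>))) (at \<rho>)"
    using assms by (simp add: add_pos_pos)
  also have "1 / (1 / \<rho> + 1) * (- 1 / (\<rho> * \<rho>)) = - 1 / (\<rho> * (\<rho> + 1))"
    using assms by (simp add: divide_simps)
  finally show ?thesis .
qed

section \<open>Sound speed of the logarithmic gas\<close>

lemma pressure_rho_deriv:
  assumes "0 < \<rho>"
  shows "((\<lambda>r. pressure_rho E r S) has_real_derivative
    K0 * exp (S / c_tau) / (\<rho> + 1)\<^sup>2 *
      (ln (1 / \<rho> + 1) powr (- 2 * \<sigma>) + 2 * \<sigma> * ln (1 / \<rho> + 1) powr (- 2 * \<sigma> - 1))) (at \<rho>)"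
proof -
  let ?L = "ln (1 / \<rho> + 1)"
  have powr: "((\<lambda>r. ln (1 / r + 1) powr (- 2 * \<sigma>)) has_real_derivative
      - 2 * \<sigma> * ?L powr (- 2 * \<sigma> - 1) * (- 1 / (\<rho> * (\<rho> + 1)))) (at \<rho>)"
    using assms
    by (intro DERIV_chain2[where f = "\<lambda>z. z powr (- 2 * \<sigma>)"] has_real_derivative_powr
        ln_inverse_pos ln_inverse_deriv)
  have frac: "((\<lambda>r. r / (r + 1)) has_real_derivative 1 / (\<rho> + 1)\<^sup>2) (at \<rho>)"
    using DERIV_divide[OF DERIV_ident DERIV_add[OF DERIV_ident DERIV_const[of 1]], of \<rho>] assms
    by (simp add: power2_eq_square)
  have alg: "K * (1 / (\<rho> + 1)\<^sup>2 * a + - 2 * \<sigma> * b * (- 1 / (\<rho> * (\<rho> + 1))) * (\<rho> / (\<rho> + 1)))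
      = K / (\<rho> + 1)\<^sup>2 * (a + 2 * \<sigma> * b)" for K a b
  proof -
    have "- 2 * \<sigma> * b * (- 1 / (\<rho> * (\<rho> + 1))) * (\<rho> / (\<rho> + 1)) = 2 * \<sigma> * b * (1 / (\<rho> + 1)\<^sup>2)"
      using assms by (simp add: power2_eq_square)
    then show ?thesis
      by (simp add: distrib_left add_divide_distrib)
  qed
  \<comment> \<open>The factor \<open>1 / (\<tau> + 1)\<close> at \<open>\<tau> = 1 / r\<close> is
    written as \<open>r / (r + 1)\<close>; this agrees with \<open>pressure_rho\<close> on positive
    densities.\<close>
  have "((\<lambda>r. K0 * exp (S / c_tau) * (r / (r + 1) * ln (1 / r + 1) powr (- 2 * \<sigma>)))
    has_real_derivative K0 * exp (S / c_tau) / (\<rho> + 1)\<^sup>2 *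
      (?L powr (- 2 * \<sigma>) + 2 * \<sigma> * ?L powr (- 2 * \<sigma> - 1))) (at \<rho>)"
    using DERIV_cmult[OF DERIV_mult[OF frac powr], of "K0 * exp (S / c_tau)"] unfolding alg .
  then show ?thesis
  proof (rule has_field_derivative_transform_within_open)
    fix r :: real assume "r \<in> {0<..}"
    then show "K0 * exp (S / c_tau) * (r / (r + 1) * ln (1 / r + 1) powr (- 2 * \<sigma>)) =
        pressure_rho E r S"
      by (simp add: pressure_rho_def pressure_eq field_simps)
  qed (use assms in auto)
qed

lemma sound_speed_eq:
  assumes "0 < \<rho>"
  shows "sound_speed E \<rho> S = sqrt (K0 * exp (S / c_tau) / (\<rho> + 1)\<^sup>2 *
      (ln (1 / \<rho> + 1) powr (- 2 * \<sigma>) + 2 * \<sigma> * ln (1 / \<rho> + 1) powr (- 2 * \<sigma> - 1)))"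
  by (simp only: sound_speed_def DERIV_imp_deriv[OF pressure_rho_deriv[OF assms]])

text \<open>Divided by \<open>\<rho>\<close>, the lower bound is the derivative of a negative multiple of
  \<open>ln (ln (1 / \<rho> + 1))\<close>.\<close>

lemma sound_speed_ge:
  assumes "0 < \<rho>"
  shows "sqrt (K0 * exp (S / c_tau)) / ((\<rho> + 1) * ln (1 / \<rho> + 1)) \<le> sound_speed E \<rho> S"
proof -
  define L where "L = ln (1 / \<rho> + 1)"
  have L: "0 < L"
    using ln_inverse_pos[OF assms] by (simp add: L_def)
  have "L powr - 2 \<le> L powr (- 2 * \<sigma>) + 2 * \<sigma> * L powr (- 2 * \<sigma> - 1)"
  \<comment> \<open>For large \<open>L\<close> the first term dominates because \<sigma> \<le> 1;
    for small \<open>L\<close> the second does because \<sigma> > 1/2, which also makes its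
    coefficient at least 1.\<close>
  proof (cases "1 \<le> L")
    case True
    then have "L powr - 2 \<le> L powr (- 2 * \<sigma>)"
      using \<sigma>_le by (intro powr_mono) auto
    moreover have "0 \<le> 2 * \<sigma> * L powr (- 2 * \<sigma> - 1)"
      using \<sigma>_gt by simp
    ultimately show ?thesis by linarith
  next
    case False
    then have "L powr - 2 \<le> L powr (- 2 * \<sigma> - 1)"
      using L \<sigma>_gt by (intro powr_mono') auto
    also have "\<dots> \<le> 2 * \<sigma> * L powr (- 2 * \<sigma> - 1)"
      using \<sigma>_gt mult_right_mono[of 1 "2 * \<sigma>" "L powr (- 2 * \<sigma> - 1)"] by simp
    finally show ?thesis
      by (simp add: add_increasing)
  qed
  moreover have "L powr - 2 = 1 / L\<^sup>2"
    using L by (simp add: powr_minus powr_numeral field_simps)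
  ultimately have "K0 * exp (S / c_tau) / (\<rho> + 1)\<^sup>2 * (1 / L\<^sup>2) \<le> K0 * exp (S / c_tau) / (\<rho> + 1)\<^sup>2 *
      (L powr (- 2 * \<sigma>) + 2 * \<sigma> * L powr (- 2 * \<sigma> - 1))"
    using K0_pos by (intro mult_left_mono) auto
  moreover have "sqrt (K0 * exp (S / c_tau)) / ((\<rho> + 1) * L) =
      sqrt (K0 * exp (S / c_tau) / (\<rho> + 1)\<^sup>2 * (1 / L\<^sup>2))"
    using assms L by (simp add: real_sqrt_divide real_sqrt_mult)
  ultimately show ?thesis
    unfolding sound_speed_eq[OF assms] L_def by simp
qed

lemma sound_speed_pos:
  assumes "0 < \<rho>"
  shows "0 < sound_speed E \<rho> S"
proof -
  have "0 < sqrt (K0 * exp (S / c_tau)) / ((\<rho> + 1) * ln (1 / \<rho> + 1))"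
    using assms K0_pos ln_inverse_pos by (intro divide_pos_pos mult_pos_pos) auto
  with sound_speed_ge[OF assms] show ?thesis
    by (rule less_le_trans[rotated])
qed

section \<open>Growth of the integral \<open>R_int\<close>\<close>

lemma R_deriv:
  assumes "0 < \<rho>"
  shows "((\<lambda>\<rho>. R_int E \<rho> S) has_real_derivative sound_speed E \<rho> S / \<rho>) (at \<rho>)"
proof -
  \<comment> \<open>A compact interval of positive densities that contains the base point 1 and has
    \<rho> in its interior, so that the derivative is two-sided.\<close>
  define a b where "a = min 1 \<rho> / 2" and "b = max 1 \<rho> + 1"
  have ab: "0 < a" "a \<le> 1" "1 \<le> b" "a < \<rho>" "\<rho> < b"
    using assms by (auto simp: a_def b_def min_def)
  have "continuous_on {a..b} (\<lambda>\<rho>. sqrt (K0 * exp (S / c_tau) / (\<rho> + 1)\<^sup>2 *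
      (ln (1 / \<rho> + 1) powr (- 2 * \<sigma>) + 2 * \<sigma> * ln (1 / \<rho> + 1) powr (- 2 * \<sigma> - 1))) / \<rho>)"
    using ab by (intro continuous_intros) (auto simp: add_pos_pos less_imp_neq[THEN not_sym])
  then have "continuous_on {a..b} (\<lambda>\<rho>. sound_speed E \<rho> S / \<rho>)"
    using ab by (subst continuous_on_cong[OF refl, OF arg_cong2[of _ _ _ _ "(/)"]]) (auto simp: sound_speed_eq)
  from interval_integral_FTC2[OF ab(2,3) this, of \<rho>]
  have "((\<lambda>\<rho>. R_int E \<rho> S) has_vector_derivative sound_speed E \<rho> S / \<rho>) (at \<rho> within {a..b})"
    using ab by (simp add: R_int_def)
  then show ?thesis
    using ab by (simp add: has_real_derivative_iff_has_vector_derivative at_within_Icc_at)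
qed

lemma R_unbounded: "\<exists>\<rho>>0. R_int E \<rho> S < b"
proof -
  define k where "k = sqrt (K0 * exp (S / c_tau))"
  have k: "0 < k"
    using K0_pos by (simp add: k_def)
  \<comment> \<open>By \<open>sound_speed_ge\<close> this sum is nondecreasing, so
    \<open>R_int\<close> on \<open>(0, 1]\<close> lies below \<open>f 1\<close> minus the iterated
    logarithm term.\<close>
  define f where "f \<rho> = R_int E \<rho> S + k * ln (ln (1 / \<rho> + 1))" for \<rho>
  have f_deriv: "(f has_real_derivative
      sound_speed E \<rho> S / \<rho> - k / ((\<rho> + 1) * ln (1 / \<rho> + 1)) / \<rho>) (at \<rho>)" if "0 < \<rho>" for \<rho>
  proof -
    have "((\<lambda>r. ln (ln (1 / r + 1))) has_real_derivative
        1 / ln (1 / \<rho> + 1) * (- 1 / (\<rho> * (\<rho> + 1)))) (at \<rho>)"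
      using that
      by (intro DERIV_chain2[where f = ln] DERIV_ln_divide ln_inverse_pos ln_inverse_deriv)
    from DERIV_add[OF R_deriv[OF that, of S] DERIV_cmult[OF this, of k]] show ?thesis
      unfolding f_def by (simp add: mult_ac)
  qed
  have f_mono: "f \<rho> \<le> f 1" if "0 < \<rho>" "\<rho> \<le> 1" for \<rho>
  proof (rule DERIV_nonneg_imp_nondecreasing[of \<rho> 1 f])
    fix x assume "\<rho> \<le> x" "x \<le> 1"
    then have x: "0 < x"
      using that by simp
    have "0 \<le> sound_speed E x S / x - k / ((x + 1) * ln (1 / x + 1)) / x"
      using divide_right_mono[OF sound_speed_ge[OF x, of S], of x] x by (simp add: k_def)
    with f_deriv[OF x] show "\<exists>y. (f has_real_derivative y) (at x) \<and> 0 \<le> y"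
      by blast
  qed (use that in simp)
  \<comment> \<open>\<rho> solves \<open>ln (ln (1 / \<rho> + 1)) = M\<close>. The second argument
    of \<open>max\<close> pushes \<open>R_int\<close> below \<open>b\<close>;
    \<open>0 \<le> M\<close> ensures \<rho> \<le> 1.\<close>
  define M where "M = max 0 ((f 1 - b) / k + 1)"
  define \<rho> where "\<rho> = 1 / (exp (exp M) - 1)"
  have "2 \<le> exp (1 :: real)"
    using exp_ge_add_one_self[of 1] by simp
  also have "\<dots> \<le> exp (exp M)"
    by (simp add: M_def)
  finally have \<rho>: "0 < \<rho>" "\<rho> \<le> 1"
    by (auto simp: \<rho>_def)
  have "f \<rho> = R_int E \<rho> S + k * M"
    by (simp add: f_def \<rho>_def)
  moreover have "f 1 - b < k * M"
  proof -
    have "(f 1 - b) / k < M"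
      by (simp add: M_def less_max_iff_disj)
    then show ?thesis
      using k by (simp add: field_simps)
  qed
  ultimately show ?thesis
    using f_mono[OF \<rho>] \<rho> by (intro exI[of _ \<rho>]) auto
qed

section \<open>Dependence of the pressure on volume and entropy\<close>

lemma pressure_less:
  assumes "0 < \<tau>" "\<tau> < \<tau>'"
  shows "pressure E \<tau>' S < pressure E \<tau> S"
proof -
  have "ln (\<tau>' + 1) powr (- 2 * \<sigma>) < ln (\<tau> + 1) powr (- 2 * \<sigma>)"
    using assms \<sigma>_gt by (intro powr_less_mono2_neg) auto
  moreover have "K0 * exp (S / c_tau) / (\<tau>' + 1) \<le> K0 * exp (S / c_tau) / (\<tau> + 1)"
    using assms K0_pos by (intro divide_left_mono) auto
  ultimately show ?thesis
    using assms K0_pos by (simp add: pressure_eq mult_le_less_imp_less del: times_divide_eq_left)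
qed

lemma pressure_ex:
  assumes \<tau>: "0 < \<tau>" and p: "0 < p" "p < pressure E \<tau> S"
  shows "\<exists>\<tau>'>\<tau>. pressure E \<tau>' S = p"
proof -
  define A where "A = K0 * exp (S / c_tau) * ln (\<tau> + 1) powr (- 2 * \<sigma>)"
  have A: "0 < A"
    using \<tau> K0_pos by (simp add: A_def)
  \<comment> \<open>Beyond \<tau> the logarithmic factor only decreases, so the pressure at
    \<open>T\<close> is at most \<open>A / (T + 1)\<close>, and this choice makes that at most
    \<open>p\<close>.\<close>
  define T where "T = \<tau> + A / p"
  have T: "\<tau> < T"
    using A p by (simp add: T_def)
  have "ln (T + 1) powr (- 2 * \<sigma>) \<le> ln (\<tau> + 1) powr (- 2 * \<sigma>)"
    using T \<tau> \<sigma>_gt by (intro powr_mono2') auto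
  then have "pressure E T S \<le> A / (T + 1)"
    using T \<tau> K0_pos by (auto simp: pressure_eq A_def intro!: divide_right_mono mult_left_mono)
  also have "\<dots> \<le> p"
  proof -
    have "A \<le> p * (T + 1)"
      using \<tau> p by (simp add: T_def field_simps)
    then show ?thesis
      using \<tau> T by (simp add: field_simps)
  qed
  finally have "pressure E T S \<le> p" .
  moreover have "continuous_on {\<tau>..T} (\<lambda>t. pressure E t S)"
  proof -
    have "continuous_on {\<tau>..T}
        (\<lambda>t. K0 * exp (S / c_tau) / (t + 1) * ln (t + 1) powr (- 2 * \<sigma>))"
      using \<tau> by (intro continuous_intros) auto
    then show ?thesis
      using \<tau> by (rule_tac continuous_on_eq) (auto simp: pressure_eq)
  qed
  ultimately obtain \<tau>' where "\<tau> \<le> \<tau>'" "\<tau>' \<le> T" "pressure E \<tau>' S = p"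
    using IVT2'[of "\<lambda>t. pressure E t S" T p \<tau>] p T by auto
  moreover have "\<tau>' \<noteq> \<tau>"
    using calculation p by auto
  ultimately show ?thesis
    by (intro exI[of _ \<tau>']) auto
qed

lemma entropy_ex1:
  assumes "0 < \<tau>" "0 < p"
  shows "\<exists>!S. pressure E \<tau> S = p"
proof -
  define A where "A = K0 / (\<tau> + 1) * ln (\<tau> + 1) powr (- 2 * \<sigma>)"
  have A: "0 < A"
    using assms K0_pos by (simp add: A_def)
  have eq: "pressure E \<tau> S = A * exp (S / c_tau)" for S
    using assms by (simp add: pressure_eq A_def)
  show ?thesis
  proof (rule ex1I)
    show "pressure E \<tau> (c_tau * ln (p / A)) = p"
      using assms A c_tau_pos by (simp add: eq)
  next
    fix S assume "pressure E \<tau> S = p"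
    then have "exp (S / c_tau) = p / A"
      using A by (simp add: eq field_simps)
    then have "ln (p / A) = S / c_tau"
      by (metis ln_exp)
    then show "S = c_tau * ln (p / A)"
      using c_tau_pos by simp
  qed
qed

text \<open>\<open>G\<close> is the energy divided by the pressure: the entropy factor cancels and
  one power of the logarithm remains. It vanishes at 0 since \<open>ln 1 = 0\<close>.\<close>

sublocale riemann_gas E "\<lambda>\<tau>. (\<tau> + 1) * ln (\<tau> + 1) / (2 * \<sigma> - 1)"
proof
  fix \<tau> S :: real assume \<tau>: "0 < \<tau>"
  then show "0 < pressure E \<tau> S"
    using K0_pos by (simp add: pressure_eq)
  have "ln (\<tau> + 1) powr (- 2 * \<sigma>) * ln (\<tau> + 1) = ln (\<tau> + 1) powr (1 - 2 * \<sigma>)"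
    using \<tau> by (simp add: powr_mult_base mult.commute)
  then show "E \<tau> S = pressure E \<tau> S * ((\<tau> + 1) * ln (\<tau> + 1) / (2 * \<sigma> - 1))"
    using \<tau> by (simp add: pressure_eq log_eos_def)
next
  fix x y :: real assume "0 \<le> x" "x < y"
  then have "(x + 1) * ln (x + 1) < (y + 1) * ln (y + 1)"
    by (intro mult_strict_mono) auto
  then show "(x + 1) * ln (x + 1) / (2 * \<sigma> - 1) < (y + 1) * ln (y + 1) / (2 * \<sigma> - 1)"
    using \<sigma>_gt by (intro divide_strict_right_mono) auto
next
  fix \<rho> \<rho>' S :: real assume "0 < \<rho>" "\<rho> < \<rho>'"
  moreover have "0 < sound_speed E x S / x" if "0 < x" for x
    using that sound_speed_pos by simp
  ultimately show "R_int E \<rho> S < R_int E \<rho>' S"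
    using R_deriv
    by (intro DERIV_pos_imp_increasing[of \<rho> \<rho>' "\<lambda>\<rho>. R_int E \<rho> S"]) (meson less_le_trans)+
next
  fix S
  show "continuous_on {0<..} (\<lambda>\<rho>. R_int E \<rho> S)"
    by (rule DERIV_continuous_on[OF has_field_derivative_at_within[OF R_deriv]]) simp
next
  show "continuous_on {0..} (\<lambda>\<tau>. (\<tau> + 1) * ln (\<tau> + 1) / (2 * \<sigma> - 1))"
    using \<sigma>_gt by (intro continuous_intros) auto
qed (use pressure_less pressure_ex entropy_ex1 R_unbounded in auto)

end

theorem lemma5p1:
  fixes K0 c_tau \<sigma> :: real
  assumes "K0 > 0" and "c_tau > 0" and "1 / 2 < \<sigma>" and "\<sigma> \<le> 1"
  shows "(\<forall>\<tau> S. \<tau> > 0 \<longrightarrow>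
            pressure (log_eos K0 c_tau \<sigma>) \<tau> S
              = K0 * exp (S / c_tau) / (\<tau> + 1) * ln (\<tau> + 1) powr (- 2 * \<sigma>)) \<and>
         (\<forall>Ul Ur. dens Ul > 0 \<and> dens Ur > 0 \<longrightarrow>
            (\<exists>!w. solves_riemann (log_eos K0 c_tau \<sigma>) Ul Ur w) \<and>
            (\<forall>w. solves_riemann (log_eos K0 c_tau \<sigma>) Ul Ur w \<longrightarrow> \<not> has_vacuum w))"
proof -
  interpret log_gas K0 c_tau \<sigma>
    using assms by unfold_locales auto
  show ?thesis
    using pressure_eq riemann_ex1 no_vacuum by blast
qed

end
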